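(* Let $G$ be a simple connected graph with $n\geq 3$ vertices and $m$ edges. Let $\delta$ denote the minimum edge neighborhood degree of $G$, let $M_1=M_1(G)$, and let $a\in\mathbb{R}\setminus\{0,1\}$. Then the following statements hold. (1) If $a<0$ or $a>1$, then $KB^a(G)\geq n\delta^a+(2M_1-4m-n\delta)\bigl((\delta+1)^a-\delta^a\bigr)$. (2) If $0<a<1$, then $KB^a(G)\leq n\delta^a+(2M_1-4m-n\delta)\bigl((\delta+1)^a-\delta^a\bigr)$. (3) If $a>1$, then \[\ln\left[\prod_{v\in V(G)}S_e(v)^a\right]\leq a\left[n\ln\delta+(2M_1-4m-n\delta)(\ln(\delta+1)-\ln\delta)\right].\] In all three parts, equality holds if $G$ is a regular graph.
   Context: Graphs are finite. For a simple graph $G$ with vertex set $V(G)$ and edge set $E(G)$, $d(u)$ denotes the degree of a vertex $u$. The degree of an edge $e=uv$ is $d_G(e)=d(u)+d(v)-2$. The edge neighborhood degree $S_e(v)$ of a vertex $v$ is the sum of the degrees $d_G(e)$ of all edges $e$ incident to $v$. The first Zagreb index is $M_1(G)=\sum_{u\in V(G)}d(u)^2$. For real $a\neq 0,1$, the general Kulli-Basava index is $KB^a(G)=\sum_{v\in V(G)}S_e(v)^a$, and the general multiplicative Kulli-Basava index is $\prod_{v\in V(G)}S_e(v)^a$. *)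

theory Defs
  imports Complex_Main
begin

text \<open>Finite simple graphs are given by a vertex set and a set of edges, an edge \<open>uv\<close> being the
  two-element set \<open>{u, v}\<close>.\<close>

definition simple_graph :: "'a set \<Rightarrow> 'a set set \<Rightarrow> bool" where
  "simple_graph V E \<longleftrightarrow> finite V \<and> (\<forall>e\<in>E. e \<subseteq> V \<and> card e = 2)"

definition connected_graph :: "'a set \<Rightarrow> 'a set set \<Rightarrow> bool" where
  "connected_graph V E \<longleftrightarrow> (\<forall>u\<in>V. \<forall>v\<in>V. (u, v) \<in> {(x, y). {x, y} \<in> E}\<^sup>*)"

definition degree :: "'a set set \<Rightarrow> 'a \<Rightarrow> nat" where
  "degree E u = card {e \<in> E. u \<in> e}"

definition regular_graph :: "'a set \<Rightarrow> 'a set set \<Rightarrow> bool" where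
  "regular_graph V E \<longleftrightarrow> (\<exists>k. \<forall>v\<in>V. degree E v = k)"

text \<open>For \<open>e = {u, v}\<close> with \<open>u \<noteq> v\<close> this is \<open>d(u) + d(v) - 2\<close>; it is integer-valued so that the
  subtraction is not truncated.\<close>

definition edge_degree :: "'a set set \<Rightarrow> 'a set \<Rightarrow> int" where
  "edge_degree E e = (\<Sum>u\<in>e. int (degree E u)) - 2"

definition edge_nbhd_degree :: "'a set set \<Rightarrow> 'a \<Rightarrow> int" where
  "edge_nbhd_degree E v = (\<Sum>e | e \<in> E \<and> v \<in> e. edge_degree E e)"

definition min_edge_nbhd_degree :: "'a set \<Rightarrow> 'a set set \<Rightarrow> int" where
  "min_edge_nbhd_degree V E = Min (edge_nbhd_degree E ` V)"

definition first_zagreb :: "'a set \<Rightarrow> 'a set set \<Rightarrow> nat" where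
  "first_zagreb V E = (\<Sum>u\<in>V. (degree E u)\<^sup>2)"

text \<open>In a connected graph with at least three vertices every edge neighborhood degree is positive,
  so the convention \<open>0 powr a = 0\<close> plays no role there.\<close>

definition kulli_basava :: "'a set \<Rightarrow> 'a set set \<Rightarrow> real \<Rightarrow> real" where
  "kulli_basava V E a = (\<Sum>v\<in>V. real_of_int (edge_nbhd_degree E v) powr a)"

definition mult_kulli_basava :: "'a set \<Rightarrow> 'a set set \<Rightarrow> real \<Rightarrow> real" where
  "mult_kulli_basava V E a = (\<Prod>v\<in>V. real_of_int (edge_nbhd_degree E v) powr a)"

end

theory Submission
  imports Defs "HOL-Analysis.Convex"
begin

text \<open>
  Write \<open>S v\<close> for the edge neighborhood degree. Counting incidences twice gives
  \<open>(\<Sum>v. S v) = 2 M\<^sub>1 - 4 m\<close> (\<open>sum_edge_nbhd_degree\<close>), so \<open>2 M\<^sub>1 - 4 m - n \<delta>\<close> is the total excess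
  \<open>\<Sum>v. (S v - \<delta>)\<close> of the values \<open>S v\<close> over their minimum. Each \<open>S v\<close> is an integer, so it
  is either \<open>\<delta>\<close> or at least \<open>\<delta> + 1\<close>; as a convex function \<open>f\<close> lies above the line
  through its values at \<open>\<delta>\<close> and \<open>\<delta> + 1\<close> outside the interval between them,
  \<open>f (S v) \<ge> f \<delta> + (S v - \<delta>) (f (\<delta> + 1) - f \<delta>)\<close>. Summing over the vertices
  (\<open>sum_convex_ge_unit_secant\<close>) gives every part: \<open>f x = x powr a\<close> is convex for \<open>a < 0\<close> and for
  \<open>a > 1\<close> and concave for \<open>0 < a < 1\<close>, and the logarithm of the product is \<open>a\<close> times the sum of
  the concave function \<open>ln\<close>.

  These functions are convex or concave only on the positive half-line, so \<open>\<delta> > 0\<close> is needed. This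
  is where connectedness and \<open>n \<ge> 3\<close> enter (\<open>edge_nbhd_degree_pos\<close>). In a regular graph all \<open>S v\<close>
  agree, the excess vanishes and every estimate becomes an equality.
\<close>

section \<open>Convex functions at integer points\<close>

text \<open>Unless \<open>s = d\<close>, the point \<open>d + 1\<close> lies between \<open>d\<close> and \<open>s\<close>, with weight
  \<open>1 / (s - d)\<close> on \<open>s\<close>; the convexity inequality there, multiplied by \<open>s - d\<close>, is the claim.\<close>

lemma convex_on_ge_unit_secant:
  fixes f :: "real \<Rightarrow> real" and d s :: int
  assumes f: "convex_on {0<..} f" and "0 < d" and "d \<le> s"
  shows "f s \<ge> f d + (real_of_int s - d) * (f (real_of_int d + 1) - f d)"
proof (cases "s = d")
  case False
  define t where "t = 1 / (real_of_int s - d)"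
  have sd: "real_of_int s - d \<ge> 1"
    using False \<open>d \<le> s\<close> by linarith
  then have t: "0 \<le> t" "t \<le> 1" and st: "(real_of_int s - d) * t = 1"
    by (auto simp: t_def)
  have "(1 - t) *\<^sub>R real_of_int d + t *\<^sub>R s = d + (real_of_int s - d) * t"
    by (simp add: algebra_simps)
  then have "f (real_of_int d + 1) \<le> (1 - t) * f d + t * f s"
    using convex_onD[OF f t, of d s] assms(2,3) st by simp
  then have "f (real_of_int d + 1) - f d \<le> t * (f s - f d)"
    by (simp add: algebra_simps)
  then have "(real_of_int s - d) * (f (real_of_int d + 1) - f d)
      \<le> (real_of_int s - d) * (t * (f s - f d))"
    using sd by (intro mult_left_mono) auto
  also have "\<dots> = f s - f d"
    using st by (metis mult.assoc mult_1)
  finally show ?thesis by simp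
qed simp

lemma sum_convex_ge_unit_secant:
  fixes f :: "real \<Rightarrow> real" and d :: int and g :: "'b \<Rightarrow> int"
  assumes f: "convex_on {0<..} f" and "0 < d" and g: "\<And>v. v \<in> A \<Longrightarrow> d \<le> g v"
  shows "(\<Sum>v\<in>A. f (g v))
    \<ge> card A * f d + ((\<Sum>v\<in>A. real_of_int (g v)) - card A * d) * (f (real_of_int d + 1) - f d)"
proof -
  have "card A * f d + ((\<Sum>v\<in>A. real_of_int (g v)) - card A * d) * (f (real_of_int d + 1) - f d)
      = (\<Sum>v\<in>A. f d + (real_of_int (g v) - d) * (f (real_of_int d + 1) - f d))"
    by (simp add: sum.distrib sum_subtractf flip: sum_distrib_right)
  also have "\<dots> \<le> (\<Sum>v\<in>A. f (g v))"
    using assms by (intro sum_mono convex_on_ge_unit_secant) auto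
  finally show ?thesis .
qed

lemma sum_concave_le_unit_secant:
  fixes f :: "real \<Rightarrow> real" and d :: int and g :: "'b \<Rightarrow> int"
  assumes "concave_on {0<..} f" and "0 < d" and "\<And>v. v \<in> A \<Longrightarrow> d \<le> g v"
  shows "(\<Sum>v\<in>A. f (g v))
    \<le> card A * f d + ((\<Sum>v\<in>A. real_of_int (g v)) - card A * d) * (f (real_of_int d + 1) - f d)"
  using sum_convex_ge_unit_secant[of "\<lambda>x. - f x" d A g] assms
  by (simp add: concave_on_def sum_negf algebra_simps)

lemma convex_on_powr_neg:
  fixes a :: real
  assumes "a < 0"
  shows "convex_on {0<..} (\<lambda>x. x powr a)"
proof (rule f''_ge0_imp_convex)
  fix x :: real assume "x \<in> {0<..}"
  then show "((\<lambda>x. x powr a) has_real_derivative a * x powr (a - 1)) (at x)"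
    and "((\<lambda>x. a * x powr (a - 1)) has_real_derivative a * (a - 1) * x powr (a - 2)) (at x)"
    by (auto intro!: derivative_eq_intros)
  show "a * (a - 1) * x powr (a - 2) \<ge> 0"
    using assms by (intro mult_nonneg_nonneg mult_nonpos_nonpos) auto
qed simp

lemma concave_on_powr:
  fixes a :: real
  assumes "0 \<le> a" and "a \<le> 1"
  shows "concave_on {0<..} (\<lambda>x. x powr a)"
proof (rule f''_le0_imp_concave)
  fix x :: real assume "x \<in> {0<..}"
  then show "((\<lambda>x. x powr a) has_real_derivative a * x powr (a - 1)) (at x)"
    and "((\<lambda>x. a * x powr (a - 1)) has_real_derivative a * (a - 1) * x powr (a - 2)) (at x)"
    by (auto intro!: derivative_eq_intros)
  show "a * (a - 1) * x powr (a - 2) \<le> 0"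
    using assms by (intro mult_nonpos_nonneg mult_nonneg_nonpos) auto
qed simp

section \<open>Edge neighborhood degrees\<close>

lemma simple_graph_finite_edges: "simple_graph V E \<Longrightarrow> finite E"
  unfolding simple_graph_def by (rule finite_subset[of _ "Pow V"]) auto

lemma sum_incidence_swap:
  assumes "simple_graph V E"
  shows "(\<Sum>v\<in>V. \<Sum>e | e \<in> E \<and> v \<in> e. h v e) = (\<Sum>e\<in>E. \<Sum>v\<in>e. h v e)"
proof -
  have "finite V" and sub: "\<And>e. e \<in> E \<Longrightarrow> e \<subseteq> V"
    using assms by (auto simp: simple_graph_def)
  have "(\<Sum>v\<in>V. \<Sum>e | e \<in> E \<and> v \<in> e. h v e) = (\<Sum>e\<in>E. \<Sum>v | v \<in> V \<and> v \<in> e. h v e)"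
    using \<open>finite V\<close> simple_graph_finite_edges[OF assms] by (rule sum.swap_restrict)
  also have "\<dots> = (\<Sum>e\<in>E. \<Sum>v\<in>e. h v e)"
    using sub by (intro sum.cong) auto
  finally show ?thesis .
qed

text \<open>An edge is incident to two vertices, so its degree is counted twice. The sum of
  \<open>d(u) + d(v)\<close> over the edges \<open>uv\<close> contains \<open>d(u)\<close> once for each edge at \<open>u\<close>, hence equals
  \<open>M\<^sub>1\<close>.\<close>

lemma sum_edge_nbhd_degree:
  assumes "simple_graph V E"
  shows "(\<Sum>v\<in>V. edge_nbhd_degree E v) = 2 * int (first_zagreb V E) - 4 * int (card E)"
proof -
  have card2: "\<And>e. e \<in> E \<Longrightarrow> card e = 2"
    using assms by (auto simp: simple_graph_def)
  have "(\<Sum>e\<in>E. \<Sum>u\<in>e. int (degree E u)) = (\<Sum>u\<in>V. \<Sum>e | e \<in> E \<and> u \<in> e. int (degree E u))"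
    by (rule sum_incidence_swap[OF assms, symmetric])
  also have "\<dots> = int (first_zagreb V E)"
    by (simp add: first_zagreb_def power2_eq_square flip: degree_def)
  finally have zagreb: "(\<Sum>e\<in>E. \<Sum>u\<in>e. int (degree E u)) = int (first_zagreb V E)" .
  have "(\<Sum>v\<in>V. edge_nbhd_degree E v) = (\<Sum>e\<in>E. \<Sum>v\<in>e. edge_degree E e)"
    unfolding edge_nbhd_degree_def by (rule sum_incidence_swap[OF assms])
  also have "\<dots> = (\<Sum>e\<in>E. 2 * (\<Sum>u\<in>e. int (degree E u)) - 4)"
    by (intro sum.cong) (auto simp: card2 edge_degree_def)
  also have "\<dots> = 2 * int (first_zagreb V E) - 4 * int (card E)"
    by (simp add: sum_subtractf zagreb flip: sum_distrib_left)
  finally show ?thesis .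
qed

lemma degree_pos:
  assumes "simple_graph V E" and "e \<in> E" and "u \<in> e"
  shows "degree E u > 0"
  using assms simple_graph_finite_edges[OF assms(1)] by (auto simp: degree_def card_gt_0_iff)

text \<open>Otherwise some nonempty \<open>A \<subset> V\<close> would absorb every walk that starts in it.\<close>

lemma connected_graph_edge_leaving:
  assumes "connected_graph V E" and "A \<subset> V" and "x \<in> A"
  obtains u w where "u \<in> A" and "w \<notin> A" and "{u, w} \<in> E"
proof -
  obtain y where y: "y \<in> V" "y \<notin> A"
    using assms(2) by blast
  then have walk: "(x, y) \<in> {(u, w). {u, w} \<in> E}\<^sup>*"
    using assms by (auto simp: connected_graph_def)
  have "\<exists>u w. u \<in> A \<and> w \<notin> A \<and> {u, w} \<in> E"
  proof (rule ccontr)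
    assume closed: "\<not> ?thesis"
    from walk have "y \<in> A"
      by induction (use closed \<open>x \<in> A\<close> in auto)
    with y show False by simp
  qed
  then show ?thesis using that by blast
qed

text \<open>The two ends of an edge do not exhaust \<open>V\<close>, so a second edge leaves one of them; the sum of the
  two degrees is then at least \<open>3\<close>.\<close>

lemma edge_degree_pos:
  assumes G: "simple_graph V E" and "connected_graph V E" and "card V \<ge> 3" and "e \<in> E"
  shows "edge_degree E e > 0"
proof -
  have e: "card e = 2" "e \<subseteq> V"
    using G \<open>e \<in> E\<close> by (auto simp: simple_graph_def)
  then have "finite e" "e \<subset> V" "e \<noteq> {}"
    using \<open>card V \<ge> 3\<close> by (auto intro: card_ge_0_finite)
  then obtain u w where uw: "u \<in> e" "w \<notin> e" "{u, w} \<in> E"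
    using connected_graph_edge_leaving[OF assms(2)] by blast
  have "card {e, {u, w}} \<le> degree E u"
    unfolding degree_def using uw \<open>e \<in> E\<close> simple_graph_finite_edges[OF G] by (intro card_mono) auto
  moreover have "e \<noteq> {u, w}" using uw by auto
  ultimately have two: "degree E u \<ge> 2" by simp
  have "card (e - {u}) = 1"
    using e \<open>finite e\<close> uw by simp
  then obtain v where v: "e - {u} = {v}"
    by (auto simp: card_1_singleton_iff)
  have "(\<Sum>x\<in>e. int (degree E x)) = int (degree E u) + int (degree E v)"
    using sum.remove[OF \<open>finite e\<close> \<open>u \<in> e\<close>, of "\<lambda>x. int (degree E x)"] v by simp
  moreover have "degree E v > 0"
    using degree_pos[OF G \<open>e \<in> E\<close>] v by blast
  ultimately show ?thesis
    using two by (simp add: edge_degree_def)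
qed

lemma edge_nbhd_degree_pos:
  assumes G: "simple_graph V E" and "connected_graph V E" and "card V \<ge> 3" and "v \<in> V"
  shows "edge_nbhd_degree E v > 0"
proof -
  have "{v} \<subset> V"
    using \<open>v \<in> V\<close> \<open>card V \<ge> 3\<close> by (cases "V = {v}") auto
  then obtain w where "{v, w} \<in> E"
    using connected_graph_edge_leaving[OF assms(2), of "{v}" v] by auto
  then have "{e. e \<in> E \<and> v \<in> e} \<noteq> {}" by blast
  then show ?thesis
    unfolding edge_nbhd_degree_def
    using simple_graph_finite_edges[OF G] edge_degree_pos[OF assms(1-3)]
    by (intro sum_pos) auto
qed

lemma regular_graph_edge_nbhd_degree:
  assumes G: "simple_graph V E" and "regular_graph V E"
  obtains s where "\<And>v. v \<in> V \<Longrightarrow> edge_nbhd_degree E v = s"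
proof -
  obtain k where k: "\<And>v. v \<in> V \<Longrightarrow> degree E v = k"
    using assms(2) by (auto simp: regular_graph_def)
  have edge: "edge_degree E e = 2 * int k - 2" if "e \<in> E" for e
  proof -
    have "e \<subseteq> V" "card e = 2"
      using G that by (auto simp: simple_graph_def)
    moreover from this have "(\<Sum>u\<in>e. int (degree E u)) = (\<Sum>u\<in>e. int k)"
      using k by (intro sum.cong) auto
    ultimately show ?thesis by (simp add: edge_degree_def)
  qed
  have "edge_nbhd_degree E v = int k * (2 * int k - 2)" if "v \<in> V" for v
  proof -
    have "edge_nbhd_degree E v = (\<Sum>e | e \<in> E \<and> v \<in> e. 2 * int k - 2)"
      unfolding edge_nbhd_degree_def using edge by (intro sum.cong) auto
    also have "\<dots> = int (degree E v) * (2 * int k - 2)"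
      by (simp add: degree_def)
    finally show ?thesis using k[OF that] by simp
  qed
  then show ?thesis using that by blast
qed

section \<open>Bounds for the Kulli-Basava indices\<close>

theorem corollary3p8:
  fixes V :: "'a set" and E :: "'a set set" and a n m \<delta> M\<^sub>1 :: real
  assumes "simple_graph V E" and "connected_graph V E" and "card V \<ge> 3"
    and "n = real (card V)" and "m = real (card E)"
    and "\<delta> = real_of_int (min_edge_nbhd_degree V E)"
    and "M\<^sub>1 = real (first_zagreb V E)"
    and "a \<noteq> 0" and "a \<noteq> 1"
  shows
    "(a < 0 \<or> a > 1 \<longrightarrow>
        kulli_basava V E a
          \<ge> n * \<delta> powr a + (2 * M\<^sub>1 - 4 * m - n * \<delta>) * ((\<delta> + 1) powr a - \<delta> powr a) \<and>
        (regular_graph V E \<longrightarrow>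
          kulli_basava V E a
            = n * \<delta> powr a + (2 * M\<^sub>1 - 4 * m - n * \<delta>) * ((\<delta> + 1) powr a - \<delta> powr a))) \<and>
     (0 < a \<and> a < 1 \<longrightarrow>
        kulli_basava V E a
          \<le> n * \<delta> powr a + (2 * M\<^sub>1 - 4 * m - n * \<delta>) * ((\<delta> + 1) powr a - \<delta> powr a) \<and>
        (regular_graph V E \<longrightarrow>
          kulli_basava V E a
            = n * \<delta> powr a + (2 * M\<^sub>1 - 4 * m - n * \<delta>) * ((\<delta> + 1) powr a - \<delta> powr a))) \<and>
     (a > 1 \<longrightarrow>
        ln (mult_kulli_basava V E a)
          \<le> a * (n * ln \<delta> + (2 * M\<^sub>1 - 4 * m - n * \<delta>) * (ln (\<delta> + 1) - ln \<delta>)) \<and>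
        (regular_graph V E \<longrightarrow>
          ln (mult_kulli_basava V E a)
            = a * (n * ln \<delta> + (2 * M\<^sub>1 - 4 * m - n * \<delta>) * (ln (\<delta> + 1) - ln \<delta>))))"
proof -
  define d where "d = min_edge_nbhd_degree V E"
  let ?S = "edge_nbhd_degree E"
  have \<delta>: "\<delta> = real_of_int d"
    using assms(6) by (simp add: d_def)
  have V: "finite V" "V \<noteq> {}"
    using assms(1,3) by (auto simp: simple_graph_def)
  then have "d \<in> ?S ` V" and min: "\<And>v. v \<in> V \<Longrightarrow> d \<le> ?S v"
    unfolding d_def min_edge_nbhd_degree_def by (auto intro: Min_in)
  have pos: "\<And>v. v \<in> V \<Longrightarrow> 0 < ?S v"
    using edge_nbhd_degree_pos[OF assms(1-3)] .
  with \<open>d \<in> ?S ` V\<close> have "0 < d"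
    by auto
  have total: "(\<Sum>v\<in>V. real_of_int (?S v)) = 2 * M\<^sub>1 - 4 * m"
    using arg_cong[OF sum_edge_nbhd_degree[OF assms(1)], of real_of_int] by (simp add: assms(5,7))
  have convex: "(\<Sum>v\<in>V. f (?S v)) \<ge> n * f \<delta> + (2 * M\<^sub>1 - 4 * m - n * \<delta>) * (f (\<delta> + 1) - f \<delta>)"
    if "convex_on {0<..} f" for f :: "real \<Rightarrow> real"
    using sum_convex_ge_unit_secant[OF that \<open>0 < d\<close>, of V ?S] min by (simp add: total assms(4) \<delta>)
  have concave: "(\<Sum>v\<in>V. f (?S v)) \<le> n * f \<delta> + (2 * M\<^sub>1 - 4 * m - n * \<delta>) * (f (\<delta> + 1) - f \<delta>)"
    if "concave_on {0<..} f" for f :: "real \<Rightarrow> real"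
    using sum_concave_le_unit_secant[OF that \<open>0 < d\<close>, of V ?S] min by (simp add: total assms(4) \<delta>)
  have regular: "(\<Sum>v\<in>V. f (?S v)) = n * f \<delta> + (2 * M\<^sub>1 - 4 * m - n * \<delta>) * (f (\<delta> + 1) - f \<delta>)"
    if reg: "regular_graph V E" for f :: "real \<Rightarrow> real"
  proof -
    have "\<And>v. v \<in> V \<Longrightarrow> ?S v = d"
      using regular_graph_edge_nbhd_degree[OF assms(1) reg] \<open>d \<in> ?S ` V\<close> by (metis imageE)
    then have eq: "(\<Sum>v\<in>V. h (?S v)) = n * h \<delta>" for h :: "real \<Rightarrow> real"
      by (simp add: assms(4) \<delta>)
    \<comment> \<open>The identity function instead of \<open>f\<close> shows that the excess vanishes.\<close>
    show ?thesis
      using eq[of f] eq[of "\<lambda>x. x"] total by simp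
  qed
  have ln_prod_eq: "ln (mult_kulli_basava V E a) = a * (\<Sum>v\<in>V. ln (real_of_int (?S v)))"
  proof -
    have "ln (mult_kulli_basava V E a) = (\<Sum>v\<in>V. ln (real_of_int (?S v) powr a))"
      unfolding mult_kulli_basava_def
      using V(1) by (intro ln_prod) (auto dest: pos)
    also have "\<dots> = (\<Sum>v\<in>V. a * ln (real_of_int (?S v)))"
      using pos by (intro sum.cong) (auto simp: ln_powr)
    finally show ?thesis by (simp add: sum_distrib_left)
  qed
  have "convex_on {0<..} (\<lambda>x. x powr a)" if "a < 0 \<or> a > 1"
    using that convex_on_powr_neg powr_convex[of a] by auto
  then show ?thesis
    using convex[of "\<lambda>x. x powr a"] concave[OF concave_on_powr] regular[of "\<lambda>x. x powr a"]
      concave[OF ln_concave] regular[of ln]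
    unfolding ln_prod_eq kulli_basava_def
    by (simp add: mult_left_mono)
qed

end
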